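(* Let $(C,\bar\xi)$ be a versor field in a Myller configuration with Frenet-type frame $R_F=\{P(s);\bar\xi_1,\bar\xi_2,\bar\xi_3\}$ and (nowhere) non-zero curvatures $K_1,K_2$, and suppose that $K_2'K_1-K_2K_1'$ is nowhere zero. Then $\bar\xi_2$ satisfies the differential equation $$\bar\xi_2'''+\frac1{\rho_1}(\rho_1'-\rho_2)\bar\xi_2''+\frac1{\rho_1}(\rho_3-\rho_2')\bar\xi_2'+\frac1{\rho_1}(\rho_3'-K_1)\bar\xi_2=0,$$ where $\rho_1=\frac{K_2}{K_2'K_1-K_2K_1'}$, $\rho_2=\frac1{K_1}(1+K_1'\rho_1)$ and $\rho_3=(K_1^2+K_2^2)\rho_1$.
   Context: All data are smooth. Let $C$ be a curve in Euclidean space $E^3$ with arclength parameter $s\in I$ ($I$ an interval) and position vector $\bar r(s)$, let $\bar\xi(s)$ be a unit vector field along $C$ (a versor field $(C,\bar\xi)$), and let $\pi(s)$ be a plane field along $C$ with $\bar\xi(s)\in\pi(s)$. The pair $((C,\bar\xi),(C,\pi))$ is called a Myller configuration $M=M(C,\bar\xi,\pi)$. Put $\bar\xi_1=\bar\xi$, $K_1=\|d\bar\xi/ds\|>0$ (curvature), define $\bar\xi_2$ by $\bar\xi_1'=K_1\bar\xi_2$, and $\bar\xi_3=\bar\xi_1\times\bar\xi_2$. Then $R_F=\{P(s);\bar\xi_1,\bar\xi_2,\bar\xi_3\}$ is a positively oriented orthonormal frame, the Frenet-type frame, and $$\bar\xi_1'=K_1\bar\xi_2,\quad \bar\xi_2'=-K_1\bar\xi_1+K_2\bar\xi_3,\quad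 \bar\xi_3'=-K_2\bar\xi_2,$$ which defines the torsion $K_2$. A prime denotes $d/ds$. *)

theory Defs
  imports "HOL-Analysis.Analysis"
begin

text \<open>At an end point belonging to \<open>I\<close> this is the one-sided derivative.\<close>

definition vderiv :: "real set \<Rightarrow> (real \<Rightarrow> 'a::real_normed_vector) \<Rightarrow> real \<Rightarrow> 'a" where
  "vderiv I f s = vector_derivative f (at s within I)"

definition smooth_on :: "real set \<Rightarrow> (real \<Rightarrow> 'a::real_normed_vector) \<Rightarrow> bool" where
  "smooth_on I f \<longleftrightarrow> (\<forall>n. \<forall>s\<in>I. (vderiv I ^^ n) f differentiable (at s within I))"

definition arclength_curve :: "real set \<Rightarrow> (real \<Rightarrow> real^3) \<Rightarrow> bool" where
  "arclength_curve I r \<longleftrightarrow> smooth_on I r \<and> (\<forall>s\<in>I. norm (vderiv I r s) = 1)"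

definition versor_field :: "real set \<Rightarrow> (real \<Rightarrow> real^3) \<Rightarrow> bool" where
  "versor_field I \<xi> \<longleftrightarrow> smooth_on I \<xi> \<and> (\<forall>s\<in>I. norm (\<xi> s) = 1)"

text \<open>A plane attached at the point of parameter \<open>s\<close> is represented by its direction,
  a two-dimensional linear subspace, so that \<open>\<xi> s \<in> \<pi> s\<close> is membership of free vectors.
  Smoothness of the plane field is smoothness of a unit normal.\<close>

definition plane_field :: "real set \<Rightarrow> (real \<Rightarrow> (real^3) set) \<Rightarrow> bool" where
  "plane_field I \<pi> \<longleftrightarrow>
     (\<forall>s\<in>I. subspace (\<pi> s) \<and> dim (\<pi> s) = 2) \<and>
     (\<exists>\<nu>. smooth_on I \<nu> \<and> (\<forall>s\<in>I. norm (\<nu> s) = 1 \<and> (\<forall>v\<in>\<pi> s. \<nu> s \<bullet> v = 0)))"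

definition myller_configuration ::
    "real set \<Rightarrow> (real \<Rightarrow> real^3) \<Rightarrow> (real \<Rightarrow> real^3) \<Rightarrow> (real \<Rightarrow> (real^3) set) \<Rightarrow> bool" where
  "myller_configuration I r \<xi> \<pi> \<longleftrightarrow>
     is_interval I \<and> interior I \<noteq> {} \<and>
     arclength_curve I r \<and> versor_field I \<xi> \<and> plane_field I \<pi> \<and> (\<forall>s\<in>I. \<xi> s \<in> \<pi> s)"

definition curvature1 :: "real set \<Rightarrow> (real \<Rightarrow> real^3) \<Rightarrow> real \<Rightarrow> real" where
  "curvature1 I \<xi> s = norm (vderiv I \<xi> s)"

definition frame2 :: "real set \<Rightarrow> (real \<Rightarrow> real^3) \<Rightarrow> real \<Rightarrow> real^3" where
  "frame2 I \<xi> s = vderiv I \<xi> s /\<^sub>R curvature1 I \<xi> s"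

definition frame3 :: "real set \<Rightarrow> (real \<Rightarrow> real^3) \<Rightarrow> real \<Rightarrow> real^3" where
  "frame3 I \<xi> s = cross3 (\<xi> s) (frame2 I \<xi> s)"

text \<open>The torsion is the coefficient of the third frame vector in the derivative of the
  second one; it is the function \<open>K\<^sub>2\<close> of the Frenet formulas, see \<open>frenet_formulas\<close> below.\<close>

definition curvature2 :: "real set \<Rightarrow> (real \<Rightarrow> real^3) \<Rightarrow> real \<Rightarrow> real" where
  "curvature2 I \<xi> s = vderiv I (frame2 I \<xi>) s \<bullet> frame3 I \<xi> s"

lemma at_within_interval_neq_bot:
  fixes I :: "real set"
  assumes "is_interval I" "interior I \<noteq> {}" "s \<in> I"
  shows "at s within I \<noteq> bot"
proof -
  have "I \<noteq> {x}" for x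
    using assms(2) by auto
  moreover have "connected I"
    using assms(1) by (simp add: is_interval_connected)
  ultimately have "s islimpt I"
    using assms(3) connected_imp_perfect by blast
  then show ?thesis
    by (simp add: trivial_limit_within)
qed

lemma has_vector_derivative_inner_const:
  fixes f g :: "real \<Rightarrow> 'a::real_inner"
  assumes bot: "at s within I \<noteq> bot" and s: "s \<in> I"
    and f: "(f has_vector_derivative f') (at s within I)"
    and g: "(g has_vector_derivative g') (at s within I)"
    and c: "\<And>t. t \<in> I \<Longrightarrow> f t \<bullet> g t = c"
  shows "f s \<bullet> g' + f' \<bullet> g s = 0"
proof -
  have 1: "((\<lambda>t. f t \<bullet> g t) has_vector_derivative f s \<bullet> g' + f' \<bullet> g s) (at s within I)"
    by (rule bounded_bilinear.has_vector_derivative[OF bounded_bilinear_inner f g])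
  have "((\<lambda>t. c) has_vector_derivative 0) (at s within I)"
    by simp
  then have "((\<lambda>t. f t \<bullet> g t) has_vector_derivative 0) (at s within I)"
    by (rule has_vector_derivative_transform[rotated 2]) (use s c in auto)
  from vector_derivative_unique_within[OF bot 1 this] show ?thesis .
qed

lemma orthonormal_expansion_cross3:
  fixes a b w :: "real^3"
  assumes "norm a = 1" "norm b = 1" "a \<bullet> b = 0"
  shows "w = (w \<bullet> a) *\<^sub>R a + (w \<bullet> b) *\<^sub>R b + (w \<bullet> cross3 a b) *\<^sub>R cross3 a b"
proof -
  define c where "c = cross3 a b"
  have cc: "c \<bullet> c = 1"
    using dot_cross[of a b a b] assms by (simp add: c_def dot_square_norm inner_commute)
  have ab: "a \<bullet> a = 1" "b \<bullet> b = 1" "a \<bullet> b = 0" "b \<bullet> a = 0"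
    "a \<bullet> c = 0" "b \<bullet> c = 0" "c \<bullet> a = 0" "c \<bullet> b = 0"
    using assms by (auto simp: c_def dot_square_norm inner_commute dot_cross_self)
  define v where "v = w - ((w \<bullet> a) *\<^sub>R a + (w \<bullet> b) *\<^sub>R b + (w \<bullet> c) *\<^sub>R c)"
  have v: "v \<bullet> a = 0" "v \<bullet> b = 0" "v \<bullet> c = 0"
    by (simp_all add: v_def inner_diff_left inner_add_left ab cc)
  have "cross3 v c = 0"
    unfolding c_def Lagrange by (simp add: v)
  with v(3) have "v = 0 \<or> c = 0"
    using norm_and_cross_eq_0 by blast
  then have "v = 0"
    using cc by auto
  then show ?thesis
    by (simp add: v_def c_def)
qed

lemma frenet_formulas:
  assumes M: "myller_configuration I r \<xi> \<pi>"
    and K1: "\<forall>s\<in>I. curvature1 I \<xi> s \<noteq> 0" and s: "s \<in> I"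
  shows "norm (frame2 I \<xi> s) = 1" "\<xi> s \<bullet> frame2 I \<xi> s = 0"
    and "(\<xi> has_vector_derivative curvature1 I \<xi> s *\<^sub>R frame2 I \<xi> s) (at s within I)"
    and "(frame2 I \<xi> has_vector_derivative
           - curvature1 I \<xi> s *\<^sub>R \<xi> s + curvature2 I \<xi> s *\<^sub>R frame3 I \<xi> s) (at s within I)"
    and "(frame3 I \<xi> has_vector_derivative - curvature2 I \<xi> s *\<^sub>R frame2 I \<xi> s) (at s within I)"
proof -
  let ?k = "curvature1 I \<xi>" and ?k2 = "curvature2 I \<xi>" and ?e = "frame2 I \<xi>"
  have bot: "at t within I \<noteq> bot" if "t \<in> I" for t
    using M that by (intro at_within_interval_neq_bot) (auto simp: myller_configuration_def)
  have n1: "norm (\<xi> t) = 1" if "t \<in> I" for t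
    using M that by (auto simp: myller_configuration_def versor_field_def)
  have sm: "(vderiv I ^^ n) \<xi> differentiable (at t within I)" if "t \<in> I" for n t
    using M that by (auto simp: myller_configuration_def versor_field_def smooth_on_def)
  have d1: "(\<xi> has_vector_derivative ?k t *\<^sub>R ?e t) (at t within I)" if "t \<in> I" for t
  proof -
    have "(\<xi> has_vector_derivative vderiv I \<xi> t) (at t within I)"
      using sm[OF that, of 0] by (simp add: vderiv_def vector_derivative_works[symmetric])
    moreover have "?k t *\<^sub>R ?e t = vderiv I \<xi> t"
      using K1 that by (simp add: frame2_def)
    ultimately show ?thesis
      by simp
  qed
  have ne: "norm (?e t) = 1" if "t \<in> I" for t
    using K1 that by (simp add: frame2_def curvature1_def)
  have orth: "\<xi> t \<bullet> ?e t = 0" if "t \<in> I" for t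
  proof -
    have "\<xi> t \<bullet> (?k t *\<^sub>R ?e t) + (?k t *\<^sub>R ?e t) \<bullet> \<xi> t = 0"
      using has_vector_derivative_inner_const[OF bot[OF that] that d1[OF that] d1[OF that], of 1] n1
      by (simp add: dot_square_norm)
    then show ?thesis
      using K1 that by (simp add: inner_commute)
  qed
  have du: "vderiv I \<xi> differentiable (at s within I)"
    using sm[OF s, of 1] by simp
  have "norm \<circ> vderiv I \<xi> differentiable (at s within I)"
  proof (rule differentiable_chain_within[OF du])
    have "vderiv I \<xi> s \<noteq> 0"
      using K1 s by (auto simp: curvature1_def)
    then show "norm differentiable (at (vderiv I \<xi> s) within vderiv I \<xi> ` I)"
      by (rule differentiable_at_withinI[OF differentiable_norm_at])
  qed
  then have "?k differentiable (at s within I)"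
    by (simp add: o_def curvature1_def[abs_def])
  with du K1 s have "?e differentiable (at s within I)"
    unfolding frame2_def[abs_def] by (intro differentiable_scaleR differentiable_inverse) auto
  then have e: "(?e has_vector_derivative vderiv I ?e s) (at s within I)"
    by (simp add: vderiv_def vector_derivative_works[symmetric])
  have "\<xi> s \<bullet> vderiv I ?e s + (?k s *\<^sub>R ?e s) \<bullet> ?e s = 0"
    by (rule has_vector_derivative_inner_const[OF bot[OF s] s d1[OF s] e orth])
  then have 1: "vderiv I ?e s \<bullet> \<xi> s = - ?k s"
    using ne[OF s] by (simp add: dot_square_norm inner_commute)
  have "?e s \<bullet> vderiv I ?e s + vderiv I ?e s \<bullet> ?e s = 0"
    using has_vector_derivative_inner_const[OF bot[OF s] s e e, of 1] ne
    by (simp add: dot_square_norm)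
  then have 2: "vderiv I ?e s \<bullet> ?e s = 0"
    by (simp add: inner_commute)
  have exp: "vderiv I ?e s = - ?k s *\<^sub>R \<xi> s + ?k2 s *\<^sub>R frame3 I \<xi> s"
    using orthonormal_expansion_cross3[OF n1[OF s] ne[OF s] orth[OF s], of "vderiv I ?e s"]
    by (simp add: 1 2 curvature2_def frame3_def)
  have bb: "bounded_bilinear cross3"
    using bilinear_cross bilinear_conv_bounded_bilinear by blast
  have 3: "(frame3 I \<xi> has_vector_derivative
      cross3 (\<xi> s) (vderiv I ?e s) + cross3 (?k s *\<^sub>R ?e s) (?e s)) (at s within I)"
    unfolding frame3_def[abs_def]
    by (rule bounded_bilinear.has_vector_derivative[OF bb d1[OF s] e])
  have "cross3 (\<xi> s) (vderiv I ?e s) + cross3 (?k s *\<^sub>R ?e s) (?e s) = - ?k2 s *\<^sub>R ?e s"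
    using n1[OF s] orth[OF s]
    by (simp add: exp frame3_def Cross3.right_diff_distrib cross_mult_right cross_mult_left Lagrange
        dot_square_norm)
  with 3 show "(frame3 I \<xi> has_vector_derivative - ?k2 s *\<^sub>R ?e s) (at s within I)"
    by simp
  show "(?e has_vector_derivative - ?k s *\<^sub>R \<xi> s + ?k2 s *\<^sub>R frame3 I \<xi> s) (at s within I)"
    using e exp by simp
  show "norm (?e s) = 1" "\<xi> s \<bullet> ?e s = 0"
    "(\<xi> has_vector_derivative ?k s *\<^sub>R ?e s) (at s within I)"
    using ne orth d1 s by auto
qed

end

theory Submission
  imports Defs
begin

text \<open>
  Write \<open>e\<^sub>1, e\<^sub>2, e\<^sub>3\<close> for the frame and \<open>D = K\<^sub>2' K\<^sub>1 - K\<^sub>2 K\<^sub>1'\<close>. Differentiating the second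
  Frenet formula gives \<open>e\<^sub>2'' + (K\<^sub>1\<^sup>2 + K\<^sub>2\<^sup>2) e\<^sub>2 = - K\<^sub>1' e\<^sub>1 + K\<^sub>2' e\<^sub>3\<close>, which together with
  \<open>e\<^sub>2' = - K\<^sub>1 e\<^sub>1 + K\<^sub>2 e\<^sub>3\<close> is a linear system for \<open>e\<^sub>1\<close> and \<open>e\<^sub>3\<close> of determinant \<open>- D\<close>.
  Where \<open>D\<close> does not vanish it can be solved for \<open>e\<^sub>1\<close>, and as \<open>\<rho>\<^sub>2 = K\<^sub>2' / D\<close> the solution is
  \<open>e\<^sub>1 = \<rho>\<^sub>1 e\<^sub>2'' - \<rho>\<^sub>2 e\<^sub>2' + \<rho>\<^sub>3 e\<^sub>2\<close> (\<open>frame1_from_frame2\<close>). Differentiating once more and using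
  \<open>e\<^sub>1' = K\<^sub>1 e\<^sub>2\<close> yields the equation multiplied by \<open>\<rho>\<^sub>1\<close>.

  The last step needs three derivatives of \<open>e\<^sub>2\<close> and one of each \<open>\<rho>\<^sub>i\<close>. These exist because the
  curvatures and the frame arise from the smooth field \<open>\<xi>\<close> by derivatives, products, division by
  nowhere vanishing functions and a square root of a positive function, all of which preserve
  smoothness (\<open>smooth_on_bilinear\<close>, \<open>smooth_on_inverse\<close>, \<open>smooth_on_norm\<close>).
\<close>

section \<open>Smooth functions on an interval\<close>

lemma vderiv_works:
  "f differentiable (at s within I) \<Longrightarrow> (f has_vector_derivative vderiv I f s) (at s within I)"
  by (simp add: vderiv_def vector_derivative_works[symmetric])

lemma vderiv_eqI:
  assumes "at s within I \<noteq> bot" "(f has_vector_derivative f') (at s within I)"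
  shows "vderiv I f s = f'"
  using assms by (simp add: vderiv_def vector_derivative_within)

lemma has_vector_derivative_cong_on:
  assumes "\<forall>t\<in>I. f t = g t" "s \<in> I" "(f has_vector_derivative D) (at s within I)"
  shows "(g has_vector_derivative D) (at s within I)"
  using assms by (intro has_vector_derivative_transform[OF \<open>s \<in> I\<close> _ assms(3)]) auto

text \<open>Closure of smoothness under products is an induction over the order of differentiability:
  \<open>(f g)' = f' g + f g'\<close> consists of products again, but of functions with one derivative less.
  Hence the finite orders. A function of order \<open>n\<close> can be differentiated \<open>n + 1\<close> times.\<close>

definition diff_order :: "real set \<Rightarrow> nat \<Rightarrow> (real \<Rightarrow> 'a::real_normed_vector) \<Rightarrow> bool" where
  "diff_order I n f \<longleftrightarrow> (\<forall>k\<le>n. \<forall>s\<in>I. (vderiv I ^^ k) f differentiable (at s within I))"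

lemma smooth_on_iff_diff_order: "smooth_on I f \<longleftrightarrow> (\<forall>n. diff_order I n f)"
  by (auto simp: smooth_on_def diff_order_def)

lemma diff_order_0: "diff_order I 0 f \<longleftrightarrow> (\<forall>s\<in>I. f differentiable (at s within I))"
  by (simp add: diff_order_def)

lemma diff_order_Suc:
  "diff_order I (Suc n) f \<longleftrightarrow>
     (\<forall>s\<in>I. f differentiable (at s within I)) \<and> diff_order I n (vderiv I f)"
proof -
  have *: "(\<forall>k\<le>Suc n. P k) \<longleftrightarrow> P 0 \<and> (\<forall>k\<le>n. P (Suc k))" for P
    by (metis Suc_le_mono le0 not0_implies_Suc)
  show ?thesis
    unfolding diff_order_def * by (simp add: funpow_swap1)
qed

lemma diff_order_D: "diff_order I n f \<Longrightarrow> s \<in> I \<Longrightarrow> f differentiable (at s within I)"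
  by (cases n) (auto simp: diff_order_0 diff_order_Suc)

lemma diff_order_SucD: "diff_order I (Suc n) f \<Longrightarrow> diff_order I n f"
  by (simp add: diff_order_def)

lemma diff_order_cong:
  assumes "\<forall>s\<in>I. f s = g s" "diff_order I n f"
  shows "diff_order I n g"
  using assms
proof (induction n arbitrary: f g)
  case 0
  then show ?case
    unfolding diff_order_0
    using differentiableI_vector[OF has_vector_derivative_cong_on[OF _ _ vderiv_works]] by blast
next
  case (Suc n)
  have "(f has_vector_derivative D) (at s within I) \<longleftrightarrow>
      (g has_vector_derivative D) (at s within I)" if "s \<in> I" for s D
    using has_vector_derivative_cong_on[of I f g s D] has_vector_derivative_cong_on[of I g f s D]
      that Suc.prems(1) by auto
  then have "\<forall>s\<in>I. vderiv I f s = vderiv I g s"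
    by (simp add: vderiv_def vector_derivative_def)
  moreover have "\<forall>s\<in>I. g differentiable (at s within I)"
    using differentiableI_vector[OF has_vector_derivative_cong_on[OF Suc.prems(1) _ vderiv_works]]
      Suc.prems(2) unfolding diff_order_Suc by blast
  ultimately show ?case
    using Suc unfolding diff_order_Suc by blast
qed

lemma diff_order_SucI:
  assumes bot: "\<forall>s\<in>I. at s within I \<noteq> bot"
    and f: "\<forall>s\<in>I. (f has_vector_derivative f' s) (at s within I)" and f': "diff_order I n f'"
  shows "diff_order I (Suc n) f"
proof -
  have "\<forall>s\<in>I. f' s = vderiv I f s"
    using vderiv_eqI[symmetric] bot f by blast
  then have "diff_order I n (vderiv I f)"
    using f' by (rule diff_order_cong)
  then show ?thesis
    using f differentiableI_vector unfolding diff_order_Suc by blast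
qed

lemma diff_order_const:
  assumes bot: "\<forall>s\<in>I. at s within I \<noteq> bot"
  shows "diff_order I n (\<lambda>_. c)"
proof (induction n arbitrary: c)
  case 0
  then show ?case by (simp add: diff_order_0)
next
  case (Suc n)
  then show ?case by (intro diff_order_SucI[OF bot, where f' = "\<lambda>_. 0"]) auto
qed

lemma diff_order_add:
  assumes bot: "\<forall>s\<in>I. at s within I \<noteq> bot" and "diff_order I n f" "diff_order I n g"
  shows "diff_order I n (\<lambda>s. f s + g s)"
  using assms(2,3)
proof (induction n arbitrary: f g)
  case 0
  then show ?case by (auto simp: diff_order_0)
next
  case (Suc n)
  have "\<forall>s\<in>I. ((\<lambda>s. f s + g s) has_vector_derivative vderiv I f s + vderiv I g s) (at s within I)"
    using Suc.prems by (auto intro!: has_vector_derivative_add vderiv_works simp: diff_order_Suc)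
  then show ?case
    using Suc by (intro diff_order_SucI[OF bot]) (auto simp: diff_order_Suc)
qed

lemma diff_order_bilinear:
  assumes bot: "\<forall>s\<in>I. at s within I \<noteq> bot" and b: "bounded_bilinear b"
    and "diff_order I n f" "diff_order I n g"
  shows "diff_order I n (\<lambda>s. b (f s) (g s))"
  using assms(3,4)
proof (induction n arbitrary: f g)
  case 0
  then show ?case
    unfolding diff_order_0
    using differentiableI_vector[OF bounded_bilinear.has_vector_derivative[OF b vderiv_works vderiv_works]]
    by blast
next
  case (Suc n)
  have "\<forall>s\<in>I. ((\<lambda>s. b (f s) (g s)) has_vector_derivative
      b (f s) (vderiv I g s) + b (vderiv I f s) (g s)) (at s within I)"
    using Suc.prems
    by (auto intro!: bounded_bilinear.has_vector_derivative[OF b] vderiv_works simp: diff_order_Suc)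
  moreover have "diff_order I n (\<lambda>s. b (f s) (vderiv I g s) + b (vderiv I f s) (g s))"
    using Suc.prems diff_order_SucD[OF Suc.prems(1)] diff_order_SucD[OF Suc.prems(2)]
    by (intro diff_order_add[OF bot] Suc.IH) (auto simp: diff_order_Suc)
  ultimately show ?case
    by (rule diff_order_SucI[OF bot])
qed

lemma has_vector_derivative_powr:
  fixes f :: "real \<Rightarrow> real"
  assumes "(f has_vector_derivative f') (at s within I)" "f s > 0"
  shows "((\<lambda>t. f t powr a) has_vector_derivative a * f s powr (a - 1) * f') (at s within I)"
proof -
  have "((\<lambda>t. f t powr a) has_real_derivative a * f s powr (a - 1) * f') (at s within I)"
    using assms by (intro DERIV_chain2[where f = "\<lambda>x. x powr a"] has_real_derivative_powr)
      (auto simp: has_real_derivative_iff_has_vector_derivative)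
  then show ?thesis
    by (simp add: has_real_derivative_iff_has_vector_derivative)
qed

text \<open>The derivative of \<open>f\<^sup>a\<close> contains \<open>f\<^bsup>a - 1\<^esup>\<close>, so the induction runs over all exponents at
  once. Real exponents give inverses and norms from this single induction.\<close>

lemma diff_order_powr:
  assumes bot: "\<forall>s\<in>I. at s within I \<noteq> bot" and pos: "\<forall>s\<in>I. f s > 0" and "diff_order I n f"
  shows "diff_order I n (\<lambda>s. f s powr a :: real)"
  using assms(3)
proof (induction n arbitrary: a)
  case 0
  then show ?case
    unfolding diff_order_0
    using differentiableI_vector[OF has_vector_derivative_powr[OF vderiv_works]] pos by blast
next
  case (Suc n)
  have "\<forall>s\<in>I. ((\<lambda>t. f t powr a) has_vector_derivative
      f s powr (a - 1) * (a *\<^sub>R vderiv I f s)) (at s within I)"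
    using Suc.prems pos
    by (auto simp: diff_order_Suc
        intro!: has_vector_derivative_eq_rhs[OF has_vector_derivative_powr] vderiv_works)
  moreover
  have "diff_order I n (\<lambda>s. f s powr (a - 1) * (a *\<^sub>R vderiv I f s))"
  proof (rule diff_order_bilinear[OF bot bounded_bilinear_mult])
    show "diff_order I n (\<lambda>s. f s powr (a - 1))"
      using Suc diff_order_SucD by blast
    show "diff_order I n (\<lambda>s. a *\<^sub>R vderiv I f s)"
      using Suc.prems
      by (intro diff_order_bilinear[OF bot bounded_bilinear_scaleR] diff_order_const[OF bot])
        (auto simp: diff_order_Suc)
  qed
  ultimately show ?case
    by (rule diff_order_SucI[OF bot])
qed

lemma smooth_on_cong: "\<forall>s\<in>I. f s = g s \<Longrightarrow> smooth_on I f \<Longrightarrow> smooth_on I g"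
  unfolding smooth_on_iff_diff_order using diff_order_cong by blast

lemma smooth_on_vderiv: "smooth_on I f \<Longrightarrow> smooth_on I (vderiv I f)"
  unfolding smooth_on_iff_diff_order using diff_order_Suc by blast

lemma smooth_on_has_vderiv:
  "smooth_on I f \<Longrightarrow> s \<in> I \<Longrightarrow> (f has_vector_derivative vderiv I f s) (at s within I)"
  unfolding smooth_on_iff_diff_order using diff_order_D vderiv_works by blast

lemma smooth_on_const:
  assumes "\<forall>s\<in>I. at s within I \<noteq> bot"
  shows "smooth_on I (\<lambda>_. c)"
  using assms diff_order_const unfolding smooth_on_iff_diff_order by blast

lemma smooth_on_add:
  assumes "\<forall>s\<in>I. at s within I \<noteq> bot" "smooth_on I f" "smooth_on I g"
  shows "smooth_on I (\<lambda>s. f s + g s)"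
  using assms diff_order_add unfolding smooth_on_iff_diff_order by blast

lemma smooth_on_bilinear:
  assumes "\<forall>s\<in>I. at s within I \<noteq> bot" "bounded_bilinear b" "smooth_on I f" "smooth_on I g"
  shows "smooth_on I (\<lambda>s. b (f s) (g s))"
  using assms diff_order_bilinear unfolding smooth_on_iff_diff_order by blast

lemmas smooth_on_mult = smooth_on_bilinear[OF _ bounded_bilinear_mult]
lemmas smooth_on_scaleR = smooth_on_bilinear[OF _ bounded_bilinear_scaleR]
lemmas smooth_on_inner = smooth_on_bilinear[OF _ bounded_bilinear_inner]

lemma smooth_on_diff:
  fixes f g :: "real \<Rightarrow> real"
  assumes bot: "\<forall>s\<in>I. at s within I \<noteq> bot" and "smooth_on I f" "smooth_on I g"
  shows "smooth_on I (\<lambda>s. f s - g s)"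
  using smooth_on_add[OF bot assms(2) smooth_on_mult[OF bot smooth_on_const[OF bot, of "- 1"] assms(3)]]
  by simp

lemma smooth_on_powr:
  assumes "\<forall>s\<in>I. at s within I \<noteq> bot" "\<forall>s\<in>I. f s > 0" "smooth_on I f"
  shows "smooth_on I (\<lambda>s. f s powr a :: real)"
  using assms diff_order_powr unfolding smooth_on_iff_diff_order by blast

text \<open>The sign of \<open>f\<close> is arbitrary, whereas powers need a positive base: \<open>1 / f = f \<cdot> (f\<^sup>2)\<^bsup>-1\<^esup>\<close>.\<close>

lemma smooth_on_inverse:
  fixes f :: "real \<Rightarrow> real"
  assumes bot: "\<forall>s\<in>I. at s within I \<noteq> bot" and nz: "\<forall>s\<in>I. f s \<noteq> 0" and f: "smooth_on I f"
  shows "smooth_on I (\<lambda>s. inverse (f s))"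
proof (rule smooth_on_cong)
  show "smooth_on I (\<lambda>s. f s * (f s * f s) powr (- 1))"
    using nz f by (intro smooth_on_mult smooth_on_powr bot) (auto simp: zero_less_mult_iff)
  show "\<forall>s\<in>I. f s * (f s * f s) powr (- 1) = inverse (f s)"
    using nz by (auto simp: powr_minus field_simps)
qed

lemma smooth_on_norm:
  fixes f :: "real \<Rightarrow> 'a::real_inner"
  assumes bot: "\<forall>s\<in>I. at s within I \<noteq> bot" and nz: "\<forall>s\<in>I. f s \<noteq> 0" and f: "smooth_on I f"
  shows "smooth_on I (\<lambda>s. norm (f s))"
proof (rule smooth_on_cong)
  show "smooth_on I (\<lambda>s. (f s \<bullet> f s) powr (1 / 2))"
    using nz f by (intro smooth_on_powr smooth_on_inner bot) auto
  show "\<forall>s\<in>I. (f s \<bullet> f s) powr (1 / 2) = norm (f s)"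
    by (simp add: norm_eq_sqrt_inner powr_half_sqrt)
qed

section \<open>The frame and its curvatures\<close>

lemma myller_configuration_nontrivial:
  "myller_configuration I r \<xi> \<pi> \<Longrightarrow> \<forall>s\<in>I. at s within I \<noteq> bot"
  unfolding myller_configuration_def using at_within_interval_neq_bot by blast

lemma smooth_on_frame:
  assumes M: "myller_configuration I r \<xi> \<pi>" and K1: "\<forall>s\<in>I. curvature1 I \<xi> s \<noteq> 0"
  shows "smooth_on I (curvature1 I \<xi>)" "smooth_on I (frame2 I \<xi>)" "smooth_on I (curvature2 I \<xi>)"
proof -
  note bot = myller_configuration_nontrivial[OF M]
  have xi: "smooth_on I \<xi>"
    using M by (auto simp: myller_configuration_def versor_field_def)
  show k: "smooth_on I (curvature1 I \<xi>)"
    unfolding curvature1_def[abs_def]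
    using K1 by (intro smooth_on_norm bot smooth_on_vderiv xi) (auto simp: curvature1_def)
  show e: "smooth_on I (frame2 I \<xi>)"
    unfolding frame2_def[abs_def]
    by (intro smooth_on_scaleR smooth_on_inverse bot smooth_on_vderiv xi k K1)
  have "bounded_bilinear cross3"
    using bilinear_cross bilinear_conv_bounded_bilinear by blast
  then show "smooth_on I (curvature2 I \<xi>)"
    unfolding curvature2_def[abs_def] frame3_def[abs_def]
    by (intro smooth_on_inner smooth_on_bilinear[of I cross3] bot smooth_on_vderiv xi e)
qed

lemma frame2_second_derivative:
  assumes M: "myller_configuration I r \<xi> \<pi>" and K1: "\<forall>s\<in>I. curvature1 I \<xi> s \<noteq> 0"
    and s: "s \<in> I"
  shows "vderiv I (vderiv I (frame2 I \<xi>)) s =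
    - vderiv I (curvature1 I \<xi>) s *\<^sub>R \<xi> s + vderiv I (curvature2 I \<xi>) s *\<^sub>R frame3 I \<xi> s
    - ((curvature1 I \<xi> s)\<^sup>2 + (curvature2 I \<xi> s)\<^sup>2) *\<^sub>R frame2 I \<xi> s"
proof -
  let ?k = "curvature1 I \<xi>" and ?k2 = "curvature2 I \<xi>"
  note bot = myller_configuration_nontrivial[OF M]
  note sm = smooth_on_frame[OF M K1]
  note F = frenet_formulas[OF M K1]
  have "((\<lambda>t. - (?k t *\<^sub>R \<xi> t) + ?k2 t *\<^sub>R frame3 I \<xi> t) has_vector_derivative
      - (?k s *\<^sub>R (?k s *\<^sub>R frame2 I \<xi> s) + vderiv I ?k s *\<^sub>R \<xi> s)
      + (?k2 s *\<^sub>R (- ?k2 s *\<^sub>R frame2 I \<xi> s) + vderiv I ?k2 s *\<^sub>R frame3 I \<xi> s)) (at s within I)"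
    by (intro has_vector_derivative_add has_vector_derivative_minus
        bounded_bilinear.has_vector_derivative[OF bounded_bilinear_scaleR] F(3,5)[OF s]
        smooth_on_has_vderiv[OF sm(1) s] smooth_on_has_vderiv[OF sm(3) s])
  then have "(vderiv I (frame2 I \<xi>) has_vector_derivative
      - (?k s *\<^sub>R (?k s *\<^sub>R frame2 I \<xi> s) + vderiv I ?k s *\<^sub>R \<xi> s)
      + (?k2 s *\<^sub>R (- ?k2 s *\<^sub>R frame2 I \<xi> s) + vderiv I ?k2 s *\<^sub>R frame3 I \<xi> s)) (at s within I)"
  proof (rule has_vector_derivative_cong_on[OF _ s, rotated])
    show "\<forall>t\<in>I. - (?k t *\<^sub>R \<xi> t) + ?k2 t *\<^sub>R frame3 I \<xi> t = vderiv I (frame2 I \<xi>) t"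
      using vderiv_eqI[OF _ F(4)] bot by auto
  qed
  from vderiv_eqI[OF _ this] show ?thesis
    using bot s by (simp add: algebra_simps power2_eq_square)
qed

text \<open>Cramer's rule: \<open>K\<^sub>2\<close> times the formula for \<open>e\<^sub>2''\<close> minus \<open>K\<^sub>2'\<close> times the formula for
  \<open>e\<^sub>2'\<close> eliminates \<open>e\<^sub>3\<close>.\<close>

lemma frame1_from_frame2:
  assumes M: "myller_configuration I r \<xi> \<pi>" and K1: "\<forall>s\<in>I. curvature1 I \<xi> s \<noteq> 0"
    and s: "s \<in> I"
  shows "(vderiv I (curvature2 I \<xi>) s * curvature1 I \<xi> s
        - curvature2 I \<xi> s * vderiv I (curvature1 I \<xi>) s) *\<^sub>R \<xi> s =
    curvature2 I \<xi> s *\<^sub>R vderiv I (vderiv I (frame2 I \<xi>)) s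
    - vderiv I (curvature2 I \<xi>) s *\<^sub>R vderiv I (frame2 I \<xi>) s
    + (curvature2 I \<xi> s * ((curvature1 I \<xi> s)\<^sup>2 + (curvature2 I \<xi> s)\<^sup>2)) *\<^sub>R frame2 I \<xi> s"
proof -
  have *: "vderiv I (frame2 I \<xi>) s = - curvature1 I \<xi> s *\<^sub>R \<xi> s + curvature2 I \<xi> s *\<^sub>R frame3 I \<xi> s"
    using vderiv_eqI[OF _ frenet_formulas(4)[OF M K1 s]] myller_configuration_nontrivial[OF M] s
    by auto
  show ?thesis
    unfolding frame2_second_derivative[OF M K1 s] * by (simp add: algebra_simps)
qed

section \<open>The differential equation\<close>

theorem theorem21:
  fixes I :: "real set"
    and r \<xi> \<xi>\<^sub>2 :: "real \<Rightarrow> real^3"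
    and \<pi> :: "real \<Rightarrow> (real^3) set"
    and K\<^sub>1 K\<^sub>2 \<rho>\<^sub>1 \<rho>\<^sub>2 \<rho>\<^sub>3 :: "real \<Rightarrow> real"
  assumes "myller_configuration I r \<xi> \<pi>"
    and "K\<^sub>1 = curvature1 I \<xi>" and "K\<^sub>2 = curvature2 I \<xi>" and "\<xi>\<^sub>2 = frame2 I \<xi>"
    and "\<forall>s\<in>I. K\<^sub>1 s \<noteq> 0" and "\<forall>s\<in>I. K\<^sub>2 s \<noteq> 0"
    and "\<forall>s\<in>I. vderiv I K\<^sub>2 s * K\<^sub>1 s - K\<^sub>2 s * vderiv I K\<^sub>1 s \<noteq> 0"
    and "\<forall>s\<in>I. \<rho>\<^sub>1 s = K\<^sub>2 s / (vderiv I K\<^sub>2 s * K\<^sub>1 s - K\<^sub>2 s * vderiv I K\<^sub>1 s)"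
    and "\<forall>s\<in>I. \<rho>\<^sub>2 s = 1 / K\<^sub>1 s * (1 + vderiv I K\<^sub>1 s * \<rho>\<^sub>1 s)"
    and "\<forall>s\<in>I. \<rho>\<^sub>3 s = ((K\<^sub>1 s)\<^sup>2 + (K\<^sub>2 s)\<^sup>2) * \<rho>\<^sub>1 s"
  shows "\<forall>s\<in>I.
      (vderiv I ^^ 3) \<xi>\<^sub>2 s
      + (1 / \<rho>\<^sub>1 s * (vderiv I \<rho>\<^sub>1 s - \<rho>\<^sub>2 s)) *\<^sub>R (vderiv I ^^ 2) \<xi>\<^sub>2 s
      + (1 / \<rho>\<^sub>1 s * (\<rho>\<^sub>3 s - vderiv I \<rho>\<^sub>2 s)) *\<^sub>R vderiv I \<xi>\<^sub>2 s
      + (1 / \<rho>\<^sub>1 s * (vderiv I \<rho>\<^sub>3 s - K\<^sub>1 s)) *\<^sub>R \<xi>\<^sub>2 s = 0"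
proof
  fix s assume s: "s \<in> I"
  note M = assms(1)
  note bot = myller_configuration_nontrivial[OF M]
  have k0: "\<forall>s\<in>I. curvature1 I \<xi> s \<noteq> 0"
    using assms(2,5) by simp
  note sm = smooth_on_frame[OF M k0, folded assms(2-4)]
  define D where "D t = vderiv I K\<^sub>2 t * K\<^sub>1 t - K\<^sub>2 t * vderiv I K\<^sub>1 t" for t
  have D0: "\<forall>t\<in>I. D t \<noteq> 0"
    using assms(7) by (simp add: D_def)
  have \<rho>1: "\<forall>t\<in>I. K\<^sub>2 t * inverse (D t) = \<rho>\<^sub>1 t"
    using assms(8) by (simp add: D_def divide_inverse)
  have \<rho>2: "\<forall>t\<in>I. vderiv I K\<^sub>2 t * inverse (D t) = \<rho>\<^sub>2 t"
  proof
    fix t assume t: "t \<in> I"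
    have "\<rho>\<^sub>2 t = 1 / K\<^sub>1 t * ((D t + vderiv I K\<^sub>1 t * K\<^sub>2 t) / D t)"
      using assms(9) \<rho>1[rule_format, OF t, symmetric] D0 t
      by (simp add: distrib_right divide_inverse mult.assoc)
    also have "D t + vderiv I K\<^sub>1 t * K\<^sub>2 t = vderiv I K\<^sub>2 t * K\<^sub>1 t"
      by (simp add: D_def)
    finally show "vderiv I K\<^sub>2 t * inverse (D t) = \<rho>\<^sub>2 t"
      using assms(5) t by (simp add: field_simps)
  qed
  have \<rho>3: "\<forall>t\<in>I. (K\<^sub>1 t * K\<^sub>1 t + K\<^sub>2 t * K\<^sub>2 t) * (K\<^sub>2 t * inverse (D t)) = \<rho>\<^sub>3 t"
    using assms(10) \<rho>1 by (simp add: power2_eq_square)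
  have smD: "smooth_on I (\<lambda>t. inverse (D t))"
    using D0 unfolding D_def
    by (intro smooth_on_inverse smooth_on_diff smooth_on_mult bot smooth_on_vderiv sm) auto
  have "smooth_on I \<rho>\<^sub>1" "smooth_on I \<rho>\<^sub>2" "smooth_on I \<rho>\<^sub>3"
    by (rule smooth_on_cong[OF \<rho>1] smooth_on_cong[OF \<rho>2] smooth_on_cong[OF \<rho>3],
        intro smooth_on_mult smooth_on_add bot smooth_on_vderiv sm smD)+
  note d\<rho> = this[THEN smooth_on_has_vderiv, OF s]
  let ?e1 = "vderiv I \<xi>\<^sub>2" and ?e2 = "vderiv I (vderiv I \<xi>\<^sub>2)"
  have e1: "\<rho>\<^sub>1 t *\<^sub>R ?e2 t - \<rho>\<^sub>2 t *\<^sub>R ?e1 t + \<rho>\<^sub>3 t *\<^sub>R \<xi>\<^sub>2 t = \<xi> t" if t: "t \<in> I" for t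
  proof -
    have "\<xi> t = inverse (D t) *\<^sub>R (D t *\<^sub>R \<xi> t)"
      using D0 t by simp
    also have "D t *\<^sub>R \<xi> t = K\<^sub>2 t *\<^sub>R ?e2 t - vderiv I K\<^sub>2 t *\<^sub>R ?e1 t
        + (K\<^sub>2 t * ((K\<^sub>1 t)\<^sup>2 + (K\<^sub>2 t)\<^sup>2)) *\<^sub>R \<xi>\<^sub>2 t"
      unfolding D_def by (rule frame1_from_frame2[OF M k0 t, folded assms(2-4)])
    also have "inverse (D t) *\<^sub>R \<dots> = (K\<^sub>2 t * inverse (D t)) *\<^sub>R ?e2 t
        - (vderiv I K\<^sub>2 t * inverse (D t)) *\<^sub>R ?e1 t
        + ((K\<^sub>1 t * K\<^sub>1 t + K\<^sub>2 t * K\<^sub>2 t) * (K\<^sub>2 t * inverse (D t))) *\<^sub>R \<xi>\<^sub>2 t"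
      by (simp add: algebra_simps power2_eq_square)
    finally show ?thesis
      using \<rho>1 \<rho>2 \<rho>3 t by simp
  qed
  \<comment> \<open>Both sides are differentiated; the right-hand side has the derivative \<open>K\<^sub>1 \<xi>\<^sub>2\<close>.\<close>
  have "((\<lambda>t. \<rho>\<^sub>1 t *\<^sub>R ?e2 t - \<rho>\<^sub>2 t *\<^sub>R ?e1 t + \<rho>\<^sub>3 t *\<^sub>R \<xi>\<^sub>2 t) has_vector_derivative
      (\<rho>\<^sub>1 s *\<^sub>R vderiv I ?e2 s + vderiv I \<rho>\<^sub>1 s *\<^sub>R ?e2 s)
      - (\<rho>\<^sub>2 s *\<^sub>R ?e2 s + vderiv I \<rho>\<^sub>2 s *\<^sub>R ?e1 s)
      + (\<rho>\<^sub>3 s *\<^sub>R ?e1 s + vderiv I \<rho>\<^sub>3 s *\<^sub>R \<xi>\<^sub>2 s)) (at s within I)"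
    by (intro has_vector_derivative_add has_vector_derivative_diff
        bounded_bilinear.has_vector_derivative[OF bounded_bilinear_scaleR] d\<rho>
        smooth_on_has_vderiv[OF _ s] smooth_on_vderiv sm)
  then have "(\<xi> has_vector_derivative
      (\<rho>\<^sub>1 s *\<^sub>R vderiv I ?e2 s + vderiv I \<rho>\<^sub>1 s *\<^sub>R ?e2 s)
      - (\<rho>\<^sub>2 s *\<^sub>R ?e2 s + vderiv I \<rho>\<^sub>2 s *\<^sub>R ?e1 s)
      + (\<rho>\<^sub>3 s *\<^sub>R ?e1 s + vderiv I \<rho>\<^sub>3 s *\<^sub>R \<xi>\<^sub>2 s)) (at s within I)"
    by (rule has_vector_derivative_cong_on[rotated 2]) (use e1 s in auto)
  moreover have "(\<xi> has_vector_derivative K\<^sub>1 s *\<^sub>R \<xi>\<^sub>2 s) (at s within I)"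
    using frenet_formulas(3)[OF M k0 s] assms(2,4) by simp
  ultimately have eq: "(\<rho>\<^sub>1 s *\<^sub>R vderiv I ?e2 s + vderiv I \<rho>\<^sub>1 s *\<^sub>R ?e2 s)
      - (\<rho>\<^sub>2 s *\<^sub>R ?e2 s + vderiv I \<rho>\<^sub>2 s *\<^sub>R ?e1 s)
      + (\<rho>\<^sub>3 s *\<^sub>R ?e1 s + vderiv I \<rho>\<^sub>3 s *\<^sub>R \<xi>\<^sub>2 s) = K\<^sub>1 s *\<^sub>R \<xi>\<^sub>2 s"
    using vector_derivative_unique_within bot s by blast
  have r0: "\<rho>\<^sub>1 s \<noteq> 0"
    using assms(6) D0 \<rho>1 s by force
  have "\<rho>\<^sub>1 s *\<^sub>R vderiv I ?e2 s + (vderiv I \<rho>\<^sub>1 s - \<rho>\<^sub>2 s) *\<^sub>R ?e2 s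
      + (\<rho>\<^sub>3 s - vderiv I \<rho>\<^sub>2 s) *\<^sub>R ?e1 s + (vderiv I \<rho>\<^sub>3 s - K\<^sub>1 s) *\<^sub>R \<xi>\<^sub>2 s = 0"
    using eq by (simp add: algebra_simps)
  then have "(1 / \<rho>\<^sub>1 s) *\<^sub>R (\<rho>\<^sub>1 s *\<^sub>R vderiv I ?e2 s + (vderiv I \<rho>\<^sub>1 s - \<rho>\<^sub>2 s) *\<^sub>R ?e2 s
      + (\<rho>\<^sub>3 s - vderiv I \<rho>\<^sub>2 s) *\<^sub>R ?e1 s + (vderiv I \<rho>\<^sub>3 s - K\<^sub>1 s) *\<^sub>R \<xi>\<^sub>2 s) = 0"
    by simp
  then show "(vderiv I ^^ 3) \<xi>\<^sub>2 s
      + (1 / \<rho>\<^sub>1 s * (vderiv I \<rho>\<^sub>1 s - \<rho>\<^sub>2 s)) *\<^sub>R (vderiv I ^^ 2) \<xi>\<^sub>2 s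
      + (1 / \<rho>\<^sub>1 s * (\<rho>\<^sub>3 s - vderiv I \<rho>\<^sub>2 s)) *\<^sub>R vderiv I \<xi>\<^sub>2 s
      + (1 / \<rho>\<^sub>1 s * (vderiv I \<rho>\<^sub>3 s - K\<^sub>1 s)) *\<^sub>R \<xi>\<^sub>2 s = 0"
    using r0 by (simp add: scaleR_add_right numeral_3_eq_3 numeral_2_eq_2)
qed

end
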